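(* Let $(\sigma,\mathbf{i})$ be an $e$-admissible pair of $\mathbb{M}\mathbb{C}(n)$, let $U\subseteq\mathbb{M}\mathbb{C}(n)$ be open, and let $F:U\to\mathbb{M}\mathbb{C}(n)$ be of class $C^1$. The following statements are equivalent. (i) $F$ satisfies the $(\sigma,\mathbf{i})$-Cauchy--Riemann equations on $U$, that is, $DF(\eta)[\mathbf{i}\beta]=\mathbf{i}\,DF(\eta)[\beta]$ for all $\eta\in U$ and $\beta\in\mathcal{B}_\sigma$. (ii) $DF(\eta)\circ\mathcal{L}_{\mathbf{i}}=\mathcal{L}_{\mathbf{i}}\circ DF(\eta)$ for every $\eta\in U$. (iii) For one (equivalently, for every) real basis $\beta_0,\dots,\beta_{m-1}$ of $\mathcal{B}_\sigma$, where $m=2^{n-1}$, the function $F$, viewed in the complex coordinates $z_\ell:=u_\ell+i\,v_\ell$, $0\le\ell\le m-1$ (with $i$ the usual imaginary unit of $\mathbb{C}$), is a holomorphic mapping of $m$ complex variables. In particular, the set of solutions of the $(\sigma,\mathbf{i})$-Cauchy--Riemann equations on $U$ depends only on the unit $\mathbf{i}$, and not on the involution $\sigma$.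
   Context: Let $n\ge1$. The multicomplex numbers are defined recursively by $\mathbb{M}\mathbb{C}(0)=\mathbb{R}$ and $\mathbb{M}\mathbb{C}(n)=\{\eta_1+\eta_2\mathbf{i}_n:\eta_1,\eta_2\in\mathbb{M}\mathbb{C}(n-1)\}$ with $\mathbf{i}_n^2=-1$, where $\mathbf{i}_n$ is a new formal square root of $-1$ commuting with everything. Thus $\mathbb{M}\mathbb{C}(n)$ is a commutative unital real algebra of dimension $2^n$ generated by commuting units $\mathbf{i}_1,\dots,\mathbf{i}_n$ with $\mathbf{i}_k^2=-1$, with real basis $\mathbb{I}(n):=\{\mathbf{i}_1^{a_1}\cdots\mathbf{i}_n^{a_n}: a_k\in\{0,1\}\}$. Put $\pm\mathbb{I}(n):=\{\pm\mathbf{j}:\mathbf{j}\in\mathbb{I}(n)\}$. An involution of $\mathbb{M}\mathbb{C}(n)$ is a real-linear multiplicative map $\sigma$ with $\sigma\circ\sigma=\mathrm{Id}$; it is $\mathbb{I}(n)$-preserving if it maps $\mathbb{I}(n)$ into $\pm\mathbb{I}(n)$. An $e$-admissible pair $(\sigma,\mathbf{i})$ consists of an $\mathbb{I}(n)$-preserving involution $\sigma$ and an element $\mathbf{i}\in\mathbb{I}(n)$ with $\mathbf{i}^2=-1$ and $\sigma(\mathbf{i})=-\mathbf{i}$. Write $\mathcal{L}_{\mathbf{i}}(\eta)=\mathbf{i}\eta$ for multiplication by $\mathbf{i}$ and $\mathcal{B}_\sigma:=\{\eta:\sigma(\eta)=\eta\}$. One has $\mathbb{M}\mathbb{C}(n)=\mathcal{B}_\sigma\oplus\mathbf{i}\mathcal{B}_\sigma$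 and $\dim_{\mathbb{R}}\mathcal{B}_\sigma=m:=2^{n-1}$; so, for a real basis $\beta_0,\dots,\beta_{m-1}$ of $\mathcal{B}_\sigma$, each $\eta$ is uniquely $\eta=\sum_{\ell=0}^{m-1}(u_\ell+\mathbf{i}v_\ell)\beta_\ell$ with $u_\ell,v_\ell\in\mathbb{R}$. "Class $C^1$" means continuously differentiable as a map between real vector spaces, and $DF(\eta)$ is the real differential at $\eta$. Saying that $F$, viewed in the complex coordinates $z_\ell$, is holomorphic means: with $\Phi:\mathbb{M}\mathbb{C}(n)\to\mathbb{C}^m$, $\Phi(\eta)=(u_0+iv_0,\dots,u_{m-1}+iv_{m-1})$, the map $\Phi\circ F\circ\Phi^{-1}:\Phi(U)\to\mathbb{C}^m$ is holomorphic. *)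

theory Defs
  imports "HOL-Analysis.Analysis"
begin

section \<open>Multicomplex numbers\<close>

text \<open>
  The order \<open>n \<ge> 1\<close> is the cardinality of the finite type \<open>'n\<close>, whose elements label the
  units \<open>i_1, ..., i_n\<close>. An element is given by its \<open>2 ^ n\<close> real coefficients in the monomial
  basis: \<open>mc_coeff \<eta> A\<close> is the coefficient of the product of the units labelled by \<open>A\<close>.
  Since the units commute and square to \<open>-1\<close>, the product of the monomials for \<open>A\<close> and \<open>B\<close> is
  \<open>(-1) ^ card (A \<inter> B)\<close> times the monomial for the symmetric difference of \<open>A\<close> and \<open>B\<close>.
  The recursive construction (adjoining one new square root of \<open>-1\<close> to the algebra of order
  \<open>n\<close> gives the algebra of order \<open>n + 1\<close>) is recovered at the end of this section.
\<close>

typedef 'n multicomplex = "UNIV :: ('n::finite set \<Rightarrow> real) set"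
  morphisms mc_coeff Abs_mc ..

lemma mc_coeff_Abs [simp]: "mc_coeff (Abs_mc f) = f"
  by (simp add: Abs_mc_inverse)

lemma mc_eqI: "(\<And>A. mc_coeff x A = mc_coeff y A) \<Longrightarrow> x = y"
  by (metis ext mc_coeff_inject)

lemma mc_eq_iff: "x = y \<longleftrightarrow> (\<forall>A. mc_coeff x A = mc_coeff y A)"
  using mc_eqI by blast

instantiation multicomplex :: (finite) real_vector
begin

definition "0 = Abs_mc (\<lambda>A. 0)"
definition "x + y = Abs_mc (\<lambda>A. mc_coeff x A + mc_coeff y A)"
definition "x - y = Abs_mc (\<lambda>A. mc_coeff x A - mc_coeff y A)"
definition "- x = Abs_mc (\<lambda>A. - mc_coeff x A)"
definition "r *\<^sub>R x = Abs_mc (\<lambda>A. r * mc_coeff x A)"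

instance
  by standard
    (auto simp: mc_eq_iff zero_multicomplex_def plus_multicomplex_def minus_multicomplex_def
      uminus_multicomplex_def scaleR_multicomplex_def algebra_simps)

end

lemma mc_coeff_simps [simp]:
  "mc_coeff 0 A = 0"
  "mc_coeff (x + y) A = mc_coeff x A + mc_coeff y A"
  "mc_coeff (x - y) A = mc_coeff x A - mc_coeff y A"
  "mc_coeff (- x) A = - mc_coeff x A"
  "mc_coeff (r *\<^sub>R x) A = r * mc_coeff x A"
  by (simp_all add: zero_multicomplex_def plus_multicomplex_def minus_multicomplex_def
      uminus_multicomplex_def scaleR_multicomplex_def)

lemma mc_coeff_sum [simp]: "mc_coeff (\<Sum>k\<in>S. f k) A = (\<Sum>k\<in>S. mc_coeff (f k) A)"
  by (induction S rule: infinite_finite_induct) auto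

definition mc_monom :: "'n set \<Rightarrow> 'n::finite multicomplex"
  where "mc_monom A = Abs_mc (\<lambda>B. if B = A then 1 else 0)"

lemma mc_coeff_monom [simp]: "mc_coeff (mc_monom A) B = (if B = A then 1 else 0)"
  by (simp add: mc_monom_def)

instantiation multicomplex :: (finite) real_inner
begin

definition "inner x y = (\<Sum>A\<in>UNIV. mc_coeff x A * mc_coeff y A)"
  for x y :: "'a multicomplex"
definition "norm x = sqrt (inner x x)" for x :: "'a multicomplex"
definition "sgn x = x /\<^sub>R norm x" for x :: "'a multicomplex"
definition "dist x y = norm (x - y)" for x y :: "'a multicomplex"
definition "(uniformity :: ('a multicomplex \<times> 'a multicomplex) filter) =
  (INF e\<in>{0<..}. principal {(x, y). dist x y < e})"
definition "open U \<longleftrightarrow> (\<forall>x\<in>U. eventually (\<lambda>(x', y). x' = x \<longrightarrow> y \<in> U) uniformity)"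
  for U :: "'a multicomplex set"

instance
proof
  fix x y z :: "'a multicomplex" and r :: real and U :: "'a multicomplex set"
  show "inner x y = inner y x"
    by (simp add: inner_multicomplex_def mult.commute)
  show "inner (x + y) z = inner x z + inner y z"
    by (simp add: inner_multicomplex_def algebra_simps sum.distrib)
  show "inner (r *\<^sub>R x) y = r * inner x y"
    by (simp add: inner_multicomplex_def sum_distrib_left algebra_simps)
  show "0 \<le> inner x x"
    by (simp add: inner_multicomplex_def sum_nonneg)
  show "inner x x = 0 \<longleftrightarrow> x = 0"
    by (simp add: inner_multicomplex_def mc_eq_iff sum_nonneg_eq_0_iff)
qed (simp_all add: norm_multicomplex_def sgn_multicomplex_def dist_multicomplex_def
      uniformity_multicomplex_def open_multicomplex_def)

end

lemma inner_mc_monom: "inner x (mc_monom A) = mc_coeff x A"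
  by (simp add: inner_multicomplex_def if_distrib cong: if_cong)

instantiation multicomplex :: (finite) euclidean_space
begin

definition "Basis = range mc_monom"

instance
proof
  fix x :: "'a multicomplex"
  show "(\<forall>u\<in>Basis. inner x u = 0) \<longleftrightarrow> (x = 0)"
    by (auto simp: Basis_multicomplex_def inner_mc_monom mc_eq_iff)
qed (auto simp: Basis_multicomplex_def inner_mc_monom mc_eq_iff)

end

lemma inj_mc_monom: "inj mc_monom"
proof (rule injI)
  fix A B :: "'n::finite set"
  assume "mc_monom A = mc_monom B"
  then have "mc_coeff (mc_monom A) A = mc_coeff (mc_monom B) A" by simp
  then show "A = B" by (simp split: if_splits)
qed

lemma DIM_multicomplex: "DIM('n::finite multicomplex) = 2 ^ CARD('n)"
proof -
  have "DIM('n multicomplex) = CARD('n set)"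
    unfolding Basis_multicomplex_def by (rule card_image[OF inj_mc_monom])
  then show ?thesis by (simp add: card_UNIV_set)
qed

lemma mc_expand: "x = (\<Sum>A\<in>UNIV. mc_coeff x A *\<^sub>R mc_monom A)"
  by (rule mc_eqI) (simp add: if_distrib cong: if_cong)

definition mc_sign :: "'n::finite set \<Rightarrow> 'n set \<Rightarrow> real"
  where "mc_sign A B = (-1) ^ card (A \<inter> B)"

instantiation multicomplex :: (finite) "{one, times}"
begin

definition "1 = mc_monom {}"
definition "x * y = (\<Sum>A\<in>UNIV. \<Sum>B\<in>UNIV.
  (mc_coeff x A * mc_coeff y B * mc_sign A B) *\<^sub>R mc_monom (sym_diff A B))"

instance ..

end

lemma mc_monom_mult: "mc_monom A * mc_monom B = mc_sign A B *\<^sub>R mc_monom (sym_diff A B)"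
proof -
  have *: "(mc_coeff (mc_monom A) A' * mc_coeff (mc_monom B) B' * mc_sign A' B') *\<^sub>R
      mc_monom (sym_diff A' B') =
    (if A' = A then if B' = B then mc_sign A B *\<^sub>R mc_monom (sym_diff A B) else 0 else 0)"
    for A' B' by simp
  show ?thesis
    unfolding times_multicomplex_def * by (simp add: sum.If_cases)
qed

lemma mc_mult_linear:
  fixes x y z :: "'n::finite multicomplex"
  shows "(x + y) * z = x * z + y * z" "x * (y + z) = x * y + x * z"
    "(r *\<^sub>R x) * y = r *\<^sub>R (x * y)" "x * (r *\<^sub>R y) = r *\<^sub>R (x * y)"
  by (simp_all add: times_multicomplex_def algebra_simps sum.distrib scaleR_sum_right)

lemma mc_linear_mult_left: "linear (\<lambda>x. x * (y :: 'n::finite multicomplex))"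
  by (rule linearI) (simp_all add: mc_mult_linear)

lemma mc_linear_mult_right: "linear (\<lambda>y. (x :: 'n::finite multicomplex) * y)"
  by (rule linearI) (simp_all add: mc_mult_linear)

lemma mc_sign_commute: "mc_sign A B = mc_sign B A"
  by (simp add: mc_sign_def Int_commute)

lemma mc_sign_prod: "mc_sign A B = (\<Prod>k\<in>B. if k \<in> A then -1 else 1)"
proof -
  have "B \<inter> {k. k \<in> A} = A \<inter> B" by auto
  then show ?thesis
    by (simp add: mc_sign_def prod.If_cases)
qed

lemma mc_sign_sym_diff: "mc_sign (sym_diff A B) C = mc_sign A C * mc_sign B C"
  by (auto simp: mc_sign_prod prod.distrib[symmetric] intro!: prod.cong)

lemma mc_monom_assoc:
  "(mc_monom A * mc_monom B) * mc_monom C = mc_monom A * (mc_monom B * mc_monom C)"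
proof -
  have "mc_sign A (sym_diff B C) = mc_sign A B * mc_sign A C"
    using mc_sign_sym_diff[of B C A] by (metis mc_sign_commute)
  moreover have "sym_diff (sym_diff A B) C = sym_diff A (sym_diff B C)" by auto
  ultimately show ?thesis
    by (simp only: mc_monom_mult mc_mult_linear mc_sign_sym_diff) (simp add: algebra_simps)
qed

lemma mc_linear_eqI:
  fixes f g :: "'n::finite multicomplex \<Rightarrow> 'b::real_vector"
  assumes "linear f" "linear g" "\<And>A. f (mc_monom A) = g (mc_monom A)"
  shows "f x = g x"
proof -
  have "f x = (\<Sum>A\<in>UNIV. mc_coeff x A *\<^sub>R f (mc_monom A))"
    by (subst mc_expand) (simp add: linear_sum[OF assms(1)] linear_cmul[OF assms(1)])
  also have "\<dots> = (\<Sum>A\<in>UNIV. mc_coeff x A *\<^sub>R g (mc_monom A))"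
    by (simp add: assms(3))
  also have "\<dots> = g x"
    by (subst (2) mc_expand) (simp add: linear_sum[OF assms(2)] linear_cmul[OF assms(2)])
  finally show ?thesis .
qed

instance multicomplex :: (finite) "{comm_ring_1, real_algebra_1}"
proof
  fix x y z :: "'a multicomplex" and r :: real
  show "(x * y) * z = x * (y * z)"
  proof (rule mc_linear_eqI[of "\<lambda>x. (x * y) * z" "\<lambda>x. x * (y * z)"])
    fix A
    show "(mc_monom A * y) * z = mc_monom A * (y * z)"
    proof (rule mc_linear_eqI[of "\<lambda>y. (mc_monom A * y) * z" "\<lambda>y. mc_monom A * (y * z)"])
      fix B
      show "(mc_monom A * mc_monom B) * z = mc_monom A * (mc_monom B * z)"
        by (rule mc_linear_eqI[of "\<lambda>z. (mc_monom A * mc_monom B) * z"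
              "\<lambda>z. mc_monom A * (mc_monom B * z)"])
          (auto intro!: linearI simp: mc_mult_linear mc_monom_assoc)
    qed (auto intro!: linearI simp: mc_mult_linear)
  qed (auto intro!: linearI simp: mc_mult_linear)
  show "x * y = y * x"
  proof (rule mc_linear_eqI[of "\<lambda>x. x * y" "\<lambda>x. y * x"])
    fix A
    show "mc_monom A * y = y * mc_monom A"
      by (rule mc_linear_eqI[of "\<lambda>y. mc_monom A * y" "\<lambda>y. y * mc_monom A"])
        (auto intro!: linearI
          simp: mc_mult_linear mc_monom_mult mc_sign_commute[of A] Un_commute)
  qed (auto intro!: linearI simp: mc_mult_linear)
  show "1 * x = x"
    by (rule mc_linear_eqI[of "\<lambda>x. 1 * x" "\<lambda>x. x"])
      (auto intro!: linearI
        simp: mc_mult_linear one_multicomplex_def mc_monom_mult mc_sign_def)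
  show "(x + y) * z = x * z + y * z" by (rule mc_mult_linear)
  show "(r *\<^sub>R x) * y = r *\<^sub>R (x * y)" by (rule mc_mult_linear)
  show "x * (r *\<^sub>R y) = r *\<^sub>R (x * y)" by (rule mc_mult_linear)
  show "(0 :: 'a multicomplex) \<noteq> 1"
    by (auto simp: one_multicomplex_def mc_eq_iff)
next
  fix x :: "'a multicomplex"
  show "x * 1 = x"
    by (rule mc_linear_eqI[of "\<lambda>x. x * 1" "\<lambda>x. x"])
      (auto intro!: linearI
        simp: mc_mult_linear one_multicomplex_def mc_monom_mult mc_sign_def)
  fix y z :: "'a multicomplex"
  show "x * (y + z) = x * y + x * z" by (rule mc_mult_linear)
qed

definition mc_unit :: "'n \<Rightarrow> 'n::finite multicomplex"
  where "mc_unit k = mc_monom {k}"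

lemma mc_unit_square: "mc_unit k * mc_unit k = -1"
  by (simp add: mc_unit_def mc_monom_mult mc_sign_def one_multicomplex_def)

lemma mc_monom_eq_prod: "mc_monom A = (\<Prod>k\<in>A. mc_unit k)"
proof -
  have "finite A" by simp
  then show ?thesis
  proof (induction A rule: finite_induct)
    case empty
    then show ?case by (simp add: one_multicomplex_def)
  next
    case (insert k A)
    then have "sym_diff {k} A = insert k A" "mc_sign {k} A = 1"
      by (auto simp: mc_sign_def)
    then have "mc_unit k * mc_monom A = mc_monom (insert k A)"
      by (simp only: mc_unit_def mc_monom_mult scaleR_one)
    then show ?case using insert by simp
  qed
qed

definition mc_units :: "'n::finite multicomplex set"
  where "mc_units = {(\<Prod>k\<in>UNIV. mc_unit k ^ a k) | a. \<forall>k. a k \<in> {0, 1::nat}}"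

lemma mc_units_eq_Basis: "mc_units = (Basis :: 'n::finite multicomplex set)"
proof -
  have *: "(\<Prod>k\<in>UNIV. mc_unit k ^ a k) = mc_monom {k. a k = 1}"
    if "\<forall>k. a k \<in> {0, 1}" for a :: "'n \<Rightarrow> nat"
  proof -
    have "mc_unit k ^ a k = (if k \<in> {k. a k = 1} then mc_unit k else 1)" for k
      using that[rule_format, of k] by auto
    then show ?thesis
      by (simp add: prod.If_cases mc_monom_eq_prod)
  qed
  have "mc_monom A \<in> mc_units" for A :: "'n set"
  proof -
    let ?a = "\<lambda>k. if k \<in> A then 1 else 0 :: nat"
    have "{k. ?a k = 1} = A" by simp
    then have "mc_monom A = (\<Prod>k\<in>UNIV. mc_unit k ^ ?a k)"
      using *[of ?a] by simp
    then show ?thesis unfolding mc_units_def by (intro CollectI exI[of _ ?a]) auto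
  qed
  then show ?thesis
    unfolding Basis_multicomplex_def using * by (auto simp: mc_units_def)
qed

text \<open>
  The recursive description. In the base case \<open>n = 1\<close> the algebra is \<open>\<real> + \<real> i_1\<close>. For the step,
  \<open>'n option\<close> has one label more than \<open>'n\<close>, and \<open>mc_lift\<close> embeds the algebra of order \<open>n\<close> as a
  unital real subalgebra in the algebra of order \<open>n + 1\<close>.
\<close>

lemma mc_base:
  fixes x :: "'n::finite multicomplex"
  assumes "CARD('n) = 1"
  shows "\<exists>!(a, b). x = of_real a + of_real b * mc_unit k"
proof -
  have U: "UNIV = {k}"
    using assms by (metis UNIV_I card_1_singletonE singletonD)
  have S: "A = {} \<or> A = {k}" for A :: "'n set"
    using U by (metis subset_UNIV subset_singletonD)
  have eq: "x = of_real a + of_real b * mc_unit k \<longleftrightarrow>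
      a = mc_coeff x {} \<and> b = mc_coeff x {k}" for a b
  proof -
    have "mc_coeff (of_real a + of_real b * mc_unit k) A =
        (if A = {} then a else b)" for A :: "'n set"
      using S[of A] by (auto simp: of_real_def one_multicomplex_def mc_unit_def
          mc_monom_mult mc_mult_linear mc_sign_def)
    then show ?thesis using S by (auto simp: mc_eq_iff)
  qed
  show ?thesis by (auto simp: eq)
qed

definition mc_lift :: "'n::finite multicomplex \<Rightarrow> 'n option multicomplex"
  where "mc_lift x = Abs_mc (\<lambda>A. if None \<in> A then 0 else mc_coeff x (Some -` A))"

lemma mc_lift_linear: "linear mc_lift"
  by (rule linearI) (auto simp: mc_lift_def mc_eq_iff)

lemma mc_lift_monom: "mc_lift (mc_monom A) = mc_monom (Some ` A)"
proof (rule mc_eqI)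
  fix B :: "'a option set"
  have "None \<notin> B \<Longrightarrow> Some ` (Some -` B) = B"
    by (auto simp: image_iff) (metis not_None_eq)
  moreover have "Some -` (Some ` A) = A" by auto
  ultimately show "mc_coeff (mc_lift (mc_monom A)) B = mc_coeff (mc_monom (Some ` A)) B"
    by (auto simp: mc_lift_def)
qed

lemma mc_lift_one: "mc_lift 1 = 1"
  by (simp add: one_multicomplex_def mc_lift_monom)

lemma mc_lift_mult: "mc_lift (x * y) = mc_lift x * mc_lift y"
proof (rule mc_linear_eqI[of "\<lambda>x. mc_lift (x * y)" "\<lambda>x. mc_lift x * mc_lift y"])
  fix A :: "'a set"
  show "mc_lift (mc_monom A * y) = mc_lift (mc_monom A) * mc_lift y"
  proof (rule mc_linear_eqI[of "\<lambda>y. mc_lift (mc_monom A * y)"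
        "\<lambda>y. mc_lift (mc_monom A) * mc_lift y"])
    fix B :: "'a set"
    have "Some ` sym_diff A B = sym_diff (Some ` A) (Some ` B)" by auto
    moreover have "mc_sign (Some ` A) (Some ` B) = mc_sign A B"
      by (simp add: mc_sign_def card_image flip: image_Int)
    ultimately show "mc_lift (mc_monom A * mc_monom B) =
        mc_lift (mc_monom A) * mc_lift (mc_monom B)"
      by (simp only: mc_monom_mult mc_lift_monom linear_cmul[OF mc_lift_linear])
  qed (auto intro!: linearI simp: algebra_simps linear_add[OF mc_lift_linear]
      linear_cmul[OF mc_lift_linear])
qed (auto intro!: linearI simp: algebra_simps linear_add[OF mc_lift_linear]
    linear_cmul[OF mc_lift_linear])

lemma mc_lift_unit: "mc_lift (mc_unit k) = mc_unit (Some k)"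
  by (simp add: mc_unit_def mc_lift_monom)

lemma mc_recursion:
  fixes z :: "'n::finite option multicomplex"
  shows "\<exists>!(x, y). z = mc_lift x + mc_lift y * mc_unit None"
proof -
  have coeff: "mc_coeff (mc_lift x + mc_lift y * mc_unit None) B =
      (if None \<in> B then mc_coeff y (Some -` B) else mc_coeff x (Some -` B))"
    for x y :: "'n multicomplex" and B
  proof -
    have "mc_coeff (mc_lift y * mc_unit None) B =
        (if None \<in> B then mc_coeff y (Some -` B) else 0)"
    proof (rule mc_linear_eqI[of "\<lambda>y. mc_coeff (mc_lift y * mc_unit None) B"
          "\<lambda>y. if None \<in> B then mc_coeff y (Some -` B) else 0"])
      fix A :: "'n set"
      have "mc_lift (mc_monom A) * mc_unit None = mc_monom (insert None (Some ` A))"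
      proof -
        have "sym_diff (Some ` A) {None} = insert None (Some ` A)" by auto
        moreover have "mc_sign (Some ` A) {None} = 1" by (simp add: mc_sign_def)
        ultimately show ?thesis
          by (simp only: mc_lift_monom mc_unit_def mc_monom_mult scaleR_one)
      qed
      moreover have "B = insert None (Some ` A) \<longleftrightarrow> None \<in> B \<and> Some -` B = A"
        by (auto simp: image_iff)
      ultimately show "mc_coeff (mc_lift (mc_monom A) * mc_unit None) B =
          (if None \<in> B then mc_coeff (mc_monom A) (Some -` B) else 0)"
        by auto
    qed (auto intro!: linearI simp: algebra_simps linear_add[OF mc_lift_linear]
        linear_cmul[OF mc_lift_linear])
    then show ?thesis by (auto simp: mc_lift_def)
  qed
  have Z: "z = mc_lift x + mc_lift y * mc_unit None \<longleftrightarrow>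
      (\<forall>B. mc_coeff z B = (if None \<in> B then mc_coeff y (Some -` B) else mc_coeff x (Some -` B)))"
    for x y by (simp only: mc_eq_iff coeff)
  have eq: "z = mc_lift x + mc_lift y * mc_unit None \<longleftrightarrow>
      x = Abs_mc (\<lambda>A. mc_coeff z (Some ` A)) \<and>
      y = Abs_mc (\<lambda>A. mc_coeff z (insert None (Some ` A)))" (is "?L \<longleftrightarrow> ?R") for x y
  proof
    have v: "Some -` (Some ` A) = A" "Some -` (insert None (Some ` A)) = A" for A :: "'n set"
      by auto
    assume ?L
    then show ?R unfolding Z by (auto simp: mc_eq_iff v)
  next
    have v: "None \<notin> B \<Longrightarrow> Some ` (Some -` B) = B"
      "None \<in> B \<Longrightarrow> insert None (Some ` (Some -` B)) = B" for B :: "'n option set"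
      by (auto simp: image_iff) (metis not_None_eq)+
    assume ?R
    then show ?L unfolding Z by (simp add: v del: image_vimage_eq)
  qed
  show ?thesis by (auto simp: eq)
qed


section \<open>Admissible pairs and Cauchy--Riemann equations\<close>

definition mc_involution :: "('n::finite multicomplex \<Rightarrow> 'n multicomplex) \<Rightarrow> bool"
  where "mc_involution \<sigma> \<longleftrightarrow>
    linear \<sigma> \<and> (\<forall>\<eta> \<zeta>. \<sigma> (\<eta> * \<zeta>) = \<sigma> \<eta> * \<sigma> \<zeta>) \<and> \<sigma> \<circ> \<sigma> = id"

definition units_preserving :: "('n::finite multicomplex \<Rightarrow> 'n multicomplex) \<Rightarrow> bool"
  where "units_preserving \<sigma> \<longleftrightarrow> \<sigma> ` mc_units \<subseteq> mc_units \<union> uminus ` mc_units"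

definition e_admissible ::
    "('n::finite multicomplex \<Rightarrow> 'n multicomplex) \<Rightarrow> 'n multicomplex \<Rightarrow> bool"
  where "e_admissible \<sigma> \<ii> \<longleftrightarrow>
    mc_involution \<sigma> \<and> units_preserving \<sigma> \<and> \<ii> \<in> mc_units \<and> \<ii>\<^sup>2 = -1 \<and> \<sigma> \<ii> = - \<ii>"

definition fixed_space ::
    "('n::finite multicomplex \<Rightarrow> 'n multicomplex) \<Rightarrow> 'n multicomplex set"
  where "fixed_space \<sigma> = {\<eta>. \<sigma> \<eta> = \<eta>}"

lemma fixed_space_subspace: "linear \<sigma> \<Longrightarrow> subspace (fixed_space \<sigma>)"
  unfolding fixed_space_def subspace_def by (simp add: linear_0 linear_add linear_cmul)

lemma fixed_space_decomposition_unique: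
  assumes "e_admissible \<sigma> \<ii>"
    and "a \<in> fixed_space \<sigma>" "b \<in> fixed_space \<sigma>" "\<eta> = a + \<ii> * b"
  shows "a = (1/2) *\<^sub>R (\<eta> + \<sigma> \<eta>)" "b = - ((1/2) *\<^sub>R (\<ii> * (\<eta> - \<sigma> \<eta>)))"
proof -
  have lin: "linear \<sigma>" and mult: "\<sigma> (x * y) = \<sigma> x * \<sigma> y"
    and i2: "\<ii> * \<ii> = -1" and si: "\<sigma> \<ii> = - \<ii>" for x y
    using assms(1) by (auto simp: e_admissible_def mc_involution_def power2_eq_square)
  have ii: "\<ii> * (\<ii> * x) = - x" for x
    by (simp add: mult.assoc[symmetric] i2)
  have "\<sigma> \<eta> = \<sigma> a + \<sigma> \<ii> * \<sigma> b"
    unfolding assms(4) linear_add[OF lin] mult by (rule refl)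
  then have "\<sigma> \<eta> = a - \<ii> * b"
    using assms(2,3) by (simp add: fixed_space_def si)
  then have *: "\<eta> + \<sigma> \<eta> = 2 *\<^sub>R a" "\<eta> - \<sigma> \<eta> = 2 *\<^sub>R (\<ii> * b)"
    using assms(4) by (simp_all add: scaleR_2)
  show "a = (1/2) *\<^sub>R (\<eta> + \<sigma> \<eta>)" "b = - ((1/2) *\<^sub>R (\<ii> * (\<eta> - \<sigma> \<eta>)))"
    unfolding * by (simp_all add: ii)
qed

lemma fixed_space_decomposition:
  assumes "e_admissible \<sigma> \<ii>"
  obtains a b where "a \<in> fixed_space \<sigma>" "b \<in> fixed_space \<sigma>" "\<eta> = a + \<ii> * b"
proof -
  have lin: "linear \<sigma>" and mult: "\<sigma> (x * y) = \<sigma> x * \<sigma> y" and ss: "\<sigma> \<circ> \<sigma> = id"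
    and i2: "\<ii> * \<ii> = -1" and si: "\<sigma> \<ii> = - \<ii>" for x y
    using assms by (auto simp: e_admissible_def mc_involution_def power2_eq_square)
  have inv: "\<sigma> (\<sigma> x) = x" for x
    using fun_cong[OF ss, of x] by simp
  note lin_simps = linear_add[OF lin] linear_diff[OF lin] linear_cmul[OF lin] linear_neg[OF lin]
  have ii: "\<ii> * (\<ii> * x) = - x" for x
    by (simp add: mult.assoc[symmetric] i2)
  let ?a = "(1/2) *\<^sub>R (\<eta> + \<sigma> \<eta>)" and ?b = "- ((1/2) *\<^sub>R (\<ii> * (\<eta> - \<sigma> \<eta>)))"
  show thesis
  proof
    show "?a \<in> fixed_space \<sigma>" "?b \<in> fixed_space \<sigma>"
      by (simp_all add: fixed_space_def lin_simps mult inv si algebra_simps)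
    have "\<ii> * ?b = (1/2) *\<^sub>R (\<eta> - \<sigma> \<eta>)"
      by (simp add: ii scaleR_diff_right)
    then have "?a + \<ii> * ?b = (1/2) *\<^sub>R (2 *\<^sub>R \<eta>)"
      by (simp only: scaleR_add_right[symmetric]) (simp add: scaleR_2)
    then show "\<eta> = ?a + \<ii> * ?b" by simp
  qed
qed

lemma dim_fixed_space:
  fixes \<sigma> :: "'n::finite multicomplex \<Rightarrow> 'n multicomplex"
  assumes "e_admissible \<sigma> \<ii>"
  shows "dim (fixed_space \<sigma>) = 2 ^ (CARD('n) - 1)"
proof -
  let ?B = "fixed_space \<sigma>" and ?L = "\<lambda>x. \<ii> * x"
  have sub: "subspace ?B"
    using assms by (simp add: e_admissible_def mc_involution_def fixed_space_subspace)
  have linL: "linear ?L" by (rule mc_linear_mult_right)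
  have i2: "\<ii> * \<ii> = -1"
    using assms by (simp add: e_admissible_def power2_eq_square)
  have "inj ?L"
  proof (rule injI)
    fix x y assume "\<ii> * x = \<ii> * y"
    then have "\<ii> * \<ii> * x = \<ii> * \<ii> * y" by (simp add: mult.assoc)
    then show "x = y" by (simp add: i2)
  qed
  then have d: "dim (?L ` ?B) = dim ?B"
    using dim_image_eq[OF linL] by (metis inj_on_subset subset_UNIV)
  have subL: "subspace (?L ` ?B)" by (rule linear_subspace_image[OF linL sub])
  have "\<eta> \<in> {x + y | x y. x \<in> ?B \<and> y \<in> ?L ` ?B}" for \<eta>
  proof -
    obtain a b where "a \<in> ?B" "b \<in> ?B" "\<eta> = a + \<ii> * b"
      by (rule fixed_space_decomposition[OF assms])
    then show ?thesis by blast
  qed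
  then have "{x + y | x y. x \<in> ?B \<and> y \<in> ?L ` ?B} = UNIV" by blast
  moreover have "dim (?B \<inter> ?L ` ?B) = 0"
    unfolding dim_eq_0
  proof
    fix x assume x: "x \<in> ?B \<inter> ?L ` ?B"
    then obtain y where y: "y \<in> ?B" "x = \<ii> * y" by auto
    have "0 \<in> ?B" by (rule subspace_0[OF sub])
    moreover have "x = x + \<ii> * 0" "x = 0 + \<ii> * y" using y by simp_all
    moreover have "x \<in> ?B" using x by simp
    ultimately have "x = (1/2) *\<^sub>R (x + \<sigma> x)" "0 = (1/2) *\<^sub>R (x + \<sigma> x)"
      using fixed_space_decomposition_unique(1)[OF assms] y(1) by blast+
    then show "x \<in> {0}" by simp
  qed
  ultimately have "2 ^ CARD('n) = 2 * dim ?B"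
    using dim_sums_Int[OF sub subL] d by (simp add: DIM_multicomplex del: dim_eq_0)
  moreover have "CARD('n) > 0" by simp
  ultimately show ?thesis by (cases "CARD('n)") auto
qed

definition C1_on ::
    "('a::real_normed_vector) set \<Rightarrow> ('a \<Rightarrow> 'b::real_normed_vector) \<Rightarrow> bool"
  where "C1_on U F \<longleftrightarrow> (\<exists>F' :: 'a \<Rightarrow> 'a \<Rightarrow>\<^sub>L 'b.
    (\<forall>\<eta>\<in>U. (F has_derivative blinfun_apply (F' \<eta>)) (at \<eta>)) \<and> continuous_on U F')"

definition cauchy_riemann ::
    "('n::finite multicomplex \<Rightarrow> 'n multicomplex) \<Rightarrow> 'n multicomplex \<Rightarrow>
      'n multicomplex set \<Rightarrow> ('n multicomplex \<Rightarrow> 'n multicomplex) \<Rightarrow> bool"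
  where "cauchy_riemann \<sigma> \<ii> U F \<longleftrightarrow>
    (\<forall>\<eta>\<in>U. \<forall>\<beta>\<in>fixed_space \<sigma>.
      frechet_derivative F (at \<eta>) (\<ii> * \<beta>) = \<ii> * frechet_derivative F (at \<eta>) \<beta>)"


section \<open>Complex coordinates and holomorphic maps\<close>

text \<open>
  A type with exactly \<open>m = 2 ^ (n - 1)\<close> elements, used as index type
  for real bases of the fixed space and for the coordinates of \<open>\<complex>\<^sup>m\<close>.
\<close>

typedef 'n half_index = "{..< 2 ^ (CARD('n::finite) - 1)} :: nat set"
  by (rule exI[of _ 0]) simp

instance half_index :: (finite) finite
proof
  show "finite (UNIV :: 'a half_index set)"
    unfolding type_definition.univ[OF type_definition_half_index] by simp
qed

lemma card_half_index: "CARD('n::finite half_index) = 2 ^ (CARD('n) - 1)"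
  unfolding type_definition.card[OF type_definition_half_index] by simp

definition real_basis_of :: "('m \<Rightarrow> 'a::real_vector) \<Rightarrow> 'a set \<Rightarrow> bool"
  where "real_basis_of \<beta> B \<longleftrightarrow> inj \<beta> \<and> independent (range \<beta>) \<and> span (range \<beta>) = B"

text \<open>
  \<open>mc_coords \<ii> \<beta> \<eta>\<close> is the vector of the \<open>u_l + i v_l\<close>, where \<open>\<eta>\<close> is the sum of the
  \<open>(u_l + \<ii> v_l) \<beta>_l\<close>.
\<close>

definition mc_coords ::
    "'n::finite multicomplex \<Rightarrow> ('m \<Rightarrow> 'n multicomplex) \<Rightarrow> 'n multicomplex \<Rightarrow> complex ^ 'm"
  where "mc_coords \<ii> \<beta> \<eta> =
    (THE z. \<eta> = (\<Sum>l\<in>UNIV. (of_real (Re (z $ l)) + \<ii> * of_real (Im (z $ l))) * \<beta> l))"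

lemma mc_coords_well_defined:
  fixes \<beta> :: "'m::finite \<Rightarrow> 'n::finite multicomplex"
  assumes adm: "e_admissible \<sigma> \<ii>" and basis: "real_basis_of \<beta> (fixed_space \<sigma>)"
  shows "\<exists>!z :: complex ^ 'm.
    \<eta> = (\<Sum>l\<in>UNIV. (of_real (Re (z $ l)) + \<ii> * of_real (Im (z $ l))) * \<beta> l)"
proof -
  have inj: "inj \<beta>" and ind: "independent (range \<beta>)" and span: "span (range \<beta>) = fixed_space \<sigma>"
    using basis by (auto simp: real_basis_of_def)
  define S where "S u = (\<Sum>l\<in>UNIV. u l *\<^sub>R \<beta> l)" for u
  have expand: "(\<Sum>l\<in>UNIV. (of_real (Re (z $ l)) + \<ii> * of_real (Im (z $ l))) * \<beta> l) =
      S (\<lambda>l. Re (z $ l)) + \<ii> * S (\<lambda>l. Im (z $ l))" for z :: "complex ^ 'm"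
    by (simp add: S_def of_real_def algebra_simps sum.distrib sum_distrib_left)
  have S_in: "S u \<in> fixed_space \<sigma>" for u
    unfolding S_def span[symmetric] by (intro span_sum span_scale span_base) auto
  have S_ex: "\<exists>u. x = S u" if "x \<in> fixed_space \<sigma>" for x
  proof -
    have "x \<in> range (\<lambda>u. \<Sum>b\<in>range \<beta>. u b *\<^sub>R b)"
      using that span_finite[of "range \<beta>"] span by simp
    then obtain c where "x = (\<Sum>b\<in>range \<beta>. c b *\<^sub>R b)" by blast
    then have "x = S (c \<circ> \<beta>)"
      by (simp add: S_def sum.reindex[OF inj])
    then show ?thesis by blast
  qed
  have S_inj: "u = v" if "S u = S v" for u v
  proof
    fix l
    let ?c = "\<lambda>b. u (inv \<beta> b) - v (inv \<beta> b)"
    have "(\<Sum>b\<in>range \<beta>. ?c b *\<^sub>R b) = S u - S v"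
      by (simp add: S_def sum.reindex[OF inj] inj scaleR_diff_left sum_subtractf)
    with that have "?c (\<beta> l) = 0"
      using independentD[OF ind, of "range \<beta>" ?c "\<beta> l"] by simp
    then show "u l = v l" by (simp add: inj)
  qed
  obtain a b where ab: "a \<in> fixed_space \<sigma>" "b \<in> fixed_space \<sigma>" "\<eta> = a + \<ii> * b"
    by (rule fixed_space_decomposition[OF adm])
  obtain u v where uv: "a = S u" "b = S v"
    using S_ex ab by meson
  show ?thesis unfolding expand
  proof (rule ex1I[of _ "\<chi> l. Complex (u l) (v l)"])
    show "\<eta> = S (\<lambda>l. Re ((\<chi> l. Complex (u l) (v l)) $ l)) +
        \<ii> * S (\<lambda>l. Im ((\<chi> l. Complex (u l) (v l)) $ l))"
      using ab uv by simp
  next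
    fix z :: "complex ^ 'm"
    assume "\<eta> = S (\<lambda>l. Re (z $ l)) + \<ii> * S (\<lambda>l. Im (z $ l))"
    note z = fixed_space_decomposition_unique[OF adm S_in S_in this]
    have "S (\<lambda>l. Re (z $ l)) = S u" "S (\<lambda>l. Im (z $ l)) = S v"
      using z fixed_space_decomposition_unique[OF adm ab] uv by metis+
    then have "(\<lambda>l. Re (z $ l)) = u" "(\<lambda>l. Im (z $ l)) = v"
      using S_inj by blast+
    then show "z = (\<chi> l. Complex (u l) (v l))"
      by (auto simp: vec_eq_iff complex_eq_iff)
  qed
qed

text \<open>
  Holomorphic means complex differentiable at every point:
  the Frechet derivative exists and is complex linear.
\<close>

definition holomorphic_map_on ::
    "(complex ^ 'm) set \<Rightarrow> (complex ^ 'm \<Rightarrow> complex ^ 'k) \<Rightarrow> bool"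
  where "holomorphic_map_on V G \<longleftrightarrow>
    (\<forall>z\<in>V. \<exists>G'. (G has_derivative G') (at z within V) \<and> Vector_Spaces.linear (*s) (*s) G')"

definition holomorphic_in_coords ::
    "'n::finite multicomplex \<Rightarrow> ('n half_index \<Rightarrow> 'n multicomplex) \<Rightarrow>
      'n multicomplex set \<Rightarrow> ('n multicomplex \<Rightarrow> 'n multicomplex) \<Rightarrow> bool"
  where "holomorphic_in_coords \<ii> \<beta> U F \<longleftrightarrow>
    holomorphic_map_on (mc_coords \<ii> \<beta> ` U) (mc_coords \<ii> \<beta> \<circ> F \<circ> inv (mc_coords \<ii> \<beta>))"

end

theory Submission
  imports Defs
begin

text \<open>
  The point of the theorem is that the one commutation rule \<open>D (\<ii> * x) = \<ii> * D x\<close>, for the real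
  differential \<open>D\<close> of \<open>F\<close> at a point, reads the same in each of the three descriptions.

  If the rule holds on the fixed space of \<open>\<sigma>\<close>, then it holds everywhere: the algebra is the sum of
  the fixed space and its multiple by \<open>\<ii>\<close>, and on the second summand the rule is obtained by
  multiplying by \<open>\<ii>\<close> and using \<open>\<ii>\<^sup>2 = -1\<close> (\<open>commutes_if_commutes_on_fixed_space\<close>). The global
  rule mentions \<open>\<ii>\<close> only, which is why the involution does not matter.

  The coordinate map of any real basis of the fixed space is a real linear bijection that turns
  multiplication by \<open>\<ii>\<close> into multiplication by the complex number \<open>i\<close>
  (\<open>mc_coords_mult_unit\<close>). Conjugating with it carries \<open>D\<close> to the real differential of the
  coordinate expression of \<open>F\<close>, and carries the commutation rule to complex linearity of this
  differential, that is, to holomorphy (\<open>holomorphic_in_coords_iff_commutes\<close>). Holomorphy only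
  asks for some complex linear derivative within the image of \<open>U\<close> in \<open>\<complex>\<^sup>m\<close>; that image is open, so
  the derivative is unique and must be the conjugated \<open>D\<close>. This argument works
  for one basis as well as for every basis, provided that a basis with the prescribed index type
  exists; it does because the fixed space has dimension \<open>2 ^ (n - 1)\<close> (\<open>fixed_space_basis_exists\<close>).
\<close>

section \<open>From the fixed space to the whole algebra\<close>

lemma e_admissible_mult_unit_twice:
  assumes "e_admissible \<sigma> \<ii>"
  shows "\<ii> * (\<ii> * x) = - x"
  using assms by (simp add: e_admissible_def power2_eq_square flip: mult.assoc)

text \<open>
  Writing \<open>x = a + \<ii> * b\<close> with fixed \<open>a\<close> and \<open>b\<close>, one has \<open>D (\<ii> * x) = D (\<ii> * a) - D b\<close>, and the
  hypothesis at \<open>a\<close> and at \<open>b\<close> identifies this with \<open>\<ii> * (D a + \<ii> * D b) = \<ii> * D x\<close>.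
\<close>

lemma commutes_if_commutes_on_fixed_space:
  fixes D :: "'n::finite multicomplex \<Rightarrow> 'n multicomplex"
  assumes adm: "e_admissible \<sigma> \<ii>" and lin: "linear D"
    and comm: "\<And>\<beta>. \<beta> \<in> fixed_space \<sigma> \<Longrightarrow> D (\<ii> * \<beta>) = \<ii> * D \<beta>"
  shows "D (\<ii> * x) = \<ii> * D x"
proof -
  note ii = e_admissible_mult_unit_twice[OF adm]
  obtain a b where ab: "a \<in> fixed_space \<sigma>" "b \<in> fixed_space \<sigma>" "x = a + \<ii> * b"
    by (rule fixed_space_decomposition[OF adm])
  have "D (\<ii> * x) = D (\<ii> * a) - D b"
    by (simp add: ab(3) distrib_left ii linear_diff[OF lin])
  also have "\<dots> = \<ii> * (D a + \<ii> * D b)"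
    by (simp add: comm[OF ab(1)] distrib_left ii)
  also have "\<dots> = \<ii> * D x"
    by (simp add: ab(3) linear_add[OF lin] comm[OF ab(2)])
  finally show ?thesis .
qed

lemma C1_on_imp_has_frechet_derivative:
  assumes "C1_on U F" "\<eta> \<in> U"
  shows "(F has_derivative frechet_derivative F (at \<eta>)) (at \<eta>)"
  using assms frechet_derivative_works unfolding C1_on_def differentiable_def by blast

lemma cauchy_riemann_iff_commutes:
  assumes adm: "e_admissible \<sigma> \<ii>" and C1: "C1_on U F"
  shows "cauchy_riemann \<sigma> \<ii> U F \<longleftrightarrow>
    (\<forall>\<eta>\<in>U. \<forall>x. frechet_derivative F (at \<eta>) (\<ii> * x) = \<ii> * frechet_derivative F (at \<eta>) x)"
proof -
  have "linear (frechet_derivative F (at \<eta>))" if "\<eta> \<in> U" for \<eta>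
    using C1_on_imp_has_frechet_derivative[OF C1 that] by (rule has_derivative_linear)
  then show ?thesis
    unfolding cauchy_riemann_def using commutes_if_commutes_on_fixed_space[OF adm] by blast
qed


section \<open>Complex coordinates\<close>

lemma fixed_space_basis_exists:
  fixes \<sigma> :: "'n::finite multicomplex \<Rightarrow> 'n multicomplex"
  assumes adm: "e_admissible \<sigma> \<ii>"
  obtains \<beta> :: "'n half_index \<Rightarrow> 'n multicomplex" where "real_basis_of \<beta> (fixed_space \<sigma>)"
proof -
  have sub: "subspace (fixed_space \<sigma>)"
    using adm by (simp add: e_admissible_def mc_involution_def fixed_space_subspace)
  obtain B where B: "B \<subseteq> fixed_space \<sigma>" "independent B" "fixed_space \<sigma> \<subseteq> span B"
      "card B = dim (fixed_space \<sigma>)"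
    by (rule basis_exists)
  have "finite B" using B(2) by (rule independent_imp_finite)
  moreover have "CARD('n half_index) = card B"
    using B(4) by (simp add: dim_fixed_space[OF adm] card_half_index)
  ultimately obtain \<beta> :: "'n half_index \<Rightarrow> 'n multicomplex" where \<beta>: "bij_betw \<beta> UNIV B"
    using finite_same_card_bij[OF finite] by blast
  have "span B = fixed_space \<sigma>"
    using B(1,3) span_minimal[OF B(1) sub] by blast
  with \<beta> B(2) have "real_basis_of \<beta> (fixed_space \<sigma>)"
    by (auto simp: real_basis_of_def bij_betw_def)
  then show thesis by (rule that)
qed

text \<open>
  The inverse of the coordinate map. In contrast to \<open>mc_coords\<close> it is given by a formula, so
  linearity is shown for it and transferred. Real scalars act by \<open>*\<^sub>R\<close> here rather than as
  elements of the algebra.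
\<close>

definition mc_from_coords ::
    "'n::finite multicomplex \<Rightarrow> ('m::finite \<Rightarrow> 'n multicomplex) \<Rightarrow> complex ^ 'm \<Rightarrow> 'n multicomplex"
  where "mc_from_coords \<ii> \<beta> z =
    (\<Sum>l\<in>UNIV. Re (z $ l) *\<^sub>R \<beta> l + Im (z $ l) *\<^sub>R (\<ii> * \<beta> l))"

lemma mc_from_coords_eq_of_real:
  "mc_from_coords \<ii> \<beta> z =
    (\<Sum>l\<in>UNIV. (of_real (Re (z $ l)) + \<ii> * of_real (Im (z $ l))) * \<beta> l)"
  by (simp add: mc_from_coords_def of_real_def distrib_right)

lemma linear_mc_from_coords: "linear (mc_from_coords \<ii> \<beta>)"
  by (rule linearI)
    (simp_all add: mc_from_coords_def scaleR_add_left scaleR_add_right sum.distrib scaleR_sum_right)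

lemma mc_from_coords_mult_i:
  assumes "e_admissible \<sigma> \<ii>"
  shows "mc_from_coords \<ii> \<beta> (\<i> *s z) = \<ii> * mc_from_coords \<ii> \<beta> z"
  unfolding mc_from_coords_def sum_distrib_left
  by (rule sum.cong) (simp_all add: distrib_left e_admissible_mult_unit_twice[OF assms])

context
  fixes \<sigma> :: "'n::finite multicomplex \<Rightarrow> 'n multicomplex" and \<ii> :: "'n multicomplex"
    and \<beta> :: "'m::finite \<Rightarrow> 'n multicomplex"
  assumes adm: "e_admissible \<sigma> \<ii>" and basis: "real_basis_of \<beta> (fixed_space \<sigma>)"
begin

lemma mc_from_coords_ex1: "\<exists>!z. \<eta> = mc_from_coords \<ii> \<beta> z"
  unfolding mc_from_coords_eq_of_real by (rule mc_coords_well_defined[OF adm basis])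

lemma mc_from_coords_mc_coords: "mc_from_coords \<ii> \<beta> (mc_coords \<ii> \<beta> \<eta>) = \<eta>"
proof -
  have "mc_coords \<ii> \<beta> \<eta> = (THE z. \<eta> = mc_from_coords \<ii> \<beta> z)"
    by (simp only: mc_coords_def mc_from_coords_eq_of_real)
  then show ?thesis
    using theI'[OF mc_from_coords_ex1, of \<eta>] by simp
qed

lemma mc_coords_mc_from_coords: "mc_coords \<ii> \<beta> (mc_from_coords \<ii> \<beta> z) = z"
  using mc_from_coords_ex1[of "mc_from_coords \<ii> \<beta> z"] mc_from_coords_mc_coords by metis

lemma inv_mc_coords: "inv (mc_coords \<ii> \<beta>) = mc_from_coords \<ii> \<beta>"
  by (rule inv_equality) (rule mc_from_coords_mc_coords mc_coords_mc_from_coords)+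

lemma linear_mc_coords: "linear (mc_coords \<ii> \<beta>)"
proof (rule linearI)
  note lin = linear_mc_from_coords[of \<ii> \<beta>]
  fix x y :: "'n multicomplex" and r :: real
  have "x + y = mc_from_coords \<ii> \<beta> (mc_coords \<ii> \<beta> x + mc_coords \<ii> \<beta> y)"
    by (simp add: linear_add[OF lin] mc_from_coords_mc_coords)
  then show "mc_coords \<ii> \<beta> (x + y) = mc_coords \<ii> \<beta> x + mc_coords \<ii> \<beta> y"
    by (simp only: mc_coords_mc_from_coords)
  have "r *\<^sub>R x = mc_from_coords \<ii> \<beta> (r *\<^sub>R mc_coords \<ii> \<beta> x)"
    by (simp add: linear_cmul[OF lin] mc_from_coords_mc_coords)
  then show "mc_coords \<ii> \<beta> (r *\<^sub>R x) = r *\<^sub>R mc_coords \<ii> \<beta> x"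
    by (simp only: mc_coords_mc_from_coords)
qed

text \<open>
  In coordinates, the unit \<open>\<ii>\<close> acts as the imaginary unit of \<open>\<complex>\<close>: this is what makes the
  commutation rule for a differential the same thing as its complex linearity.
\<close>

lemma mc_coords_mult_unit: "mc_coords \<ii> \<beta> (\<ii> * \<eta>) = \<i> *s mc_coords \<ii> \<beta> \<eta>"
proof -
  have "\<ii> * \<eta> = mc_from_coords \<ii> \<beta> (\<i> *s mc_coords \<ii> \<beta> \<eta>)"
    by (simp add: mc_from_coords_mult_i[OF adm] mc_from_coords_mc_coords)
  then show ?thesis
    by (simp only: mc_coords_mc_from_coords)
qed

lemma mc_coords_image_eq_vimage: "mc_coords \<ii> \<beta> ` U = mc_from_coords \<ii> \<beta> -` U"
proof
  show "mc_coords \<ii> \<beta> ` U \<subseteq> mc_from_coords \<ii> \<beta> -` U"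
    by (auto simp: mc_from_coords_mc_coords)
  show "mc_from_coords \<ii> \<beta> -` U \<subseteq> mc_coords \<ii> \<beta> ` U"
    using mc_coords_mc_from_coords by (metis image_eqI subsetI vimageE)
qed

lemma open_mc_coords_image: "open U \<Longrightarrow> open (mc_coords \<ii> \<beta> ` U)"
  unfolding mc_coords_image_eq_vimage
  by (intro open_vimage linear_continuous_on linear_mc_from_coords
      linear_conv_bounded_linear[THEN iffD1])

end


section \<open>Holomorphy as a commutation rule\<close>

text \<open>
  The scalar \<open>c\<close> acts as \<open>Re c\<close> plus \<open>Im c\<close> times the action of \<open>\<i>\<close>, so a real linear map that
  respects the action of \<open>\<i>\<close> respects every complex scalar.
\<close>

lemma complex_linear_iff:
  fixes T :: "complex ^ 'm::finite \<Rightarrow> complex ^ 'k::finite"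
  assumes lin: "linear T"
  shows "Vector_Spaces.linear (*s) (*s) T \<longleftrightarrow> (\<forall>z. T (\<i> *s z) = \<i> *s T z)"
proof
  assume "Vector_Spaces.linear (*s) (*s) T"
  then show "\<forall>z. T (\<i> *s z) = \<i> *s T z"
    by (simp add: Vector_Spaces.linear_iff)
next
  assume i: "\<forall>z. T (\<i> *s z) = \<i> *s T z"
  have split: "c *s w = Re c *\<^sub>R w + Im c *\<^sub>R (\<i> *s w)" for c and w :: "complex ^ 'a::finite"
    by (simp add: vec_eq_iff complex_eq_iff)
  have "T (c *s z) = c *s T z" for c z
    unfolding split[of c] by (simp add: linear_add[OF lin] linear_cmul[OF lin] i)
  then show "Vector_Spaces.linear (*s) (*s) T"
    by (simp add: Vector_Spaces.linear_iff linear_add[OF lin] vec.vector_space_axioms)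
qed

lemma holomorphic_in_coords_iff_commutes:
  assumes adm: "e_admissible \<sigma> \<ii>" and basis: "real_basis_of \<beta> (fixed_space \<sigma>)"
    and U: "open U" and C1: "C1_on U F"
  shows "holomorphic_in_coords \<ii> \<beta> U F \<longleftrightarrow>
    (\<forall>\<eta>\<in>U. \<forall>x. frechet_derivative F (at \<eta>) (\<ii> * x) = \<ii> * frechet_derivative F (at \<eta>) x)"
proof -
  let ?\<Phi> = "mc_coords \<ii> \<beta>" and ?\<Psi> = "mc_from_coords \<ii> \<beta>"
  let ?D = "\<lambda>\<eta>. frechet_derivative F (at \<eta>)"
  let ?T = "\<lambda>\<eta>. ?\<Phi> \<circ> ?D \<eta> \<circ> ?\<Psi>"
  note \<Psi>\<Phi> = mc_from_coords_mc_coords[OF adm basis]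
  have "(\<exists>G'. (?\<Phi> \<circ> F \<circ> ?\<Psi> has_derivative G') (at (?\<Phi> \<eta>) within ?\<Phi> ` U) \<and>
        Vector_Spaces.linear (*s) (*s) G') \<longleftrightarrow> (\<forall>x. ?D \<eta> (\<ii> * x) = \<ii> * ?D \<eta> x)"
    if \<eta>: "\<eta> \<in> U" for \<eta>
  proof -
    have within: "at (?\<Phi> \<eta>) within ?\<Phi> ` U = at (?\<Phi> \<eta>)"
      by (intro at_within_open imageI \<eta> open_mc_coords_image[OF adm basis U])
    have dF: "(F has_derivative ?D \<eta>) (at \<eta>)"
      by (rule C1_on_imp_has_frechet_derivative[OF C1 \<eta>])
    have d\<Psi>: "(?\<Psi> has_derivative ?\<Psi>) (at (?\<Phi> \<eta>))"
      by (intro linear_imp_has_derivative linear_mc_from_coords)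
    have d\<Phi>: "(?\<Phi> has_derivative ?\<Phi>) (at (F (?\<Psi> (?\<Phi> \<eta>))))"
      by (intro linear_imp_has_derivative linear_mc_coords[OF adm basis])
    have dF': "(F has_derivative ?D \<eta>) (at (?\<Psi> (?\<Phi> \<eta>)))"
      using dF by (simp only: \<Psi>\<Phi>)
    have dG: "(?\<Phi> \<circ> F \<circ> ?\<Psi> has_derivative ?T \<eta>) (at (?\<Phi> \<eta>))"
      by (rule diff_chain_at[OF d\<Psi> diff_chain_at[OF dF' d\<Phi>]])
    have inj: "?\<Phi> x = ?\<Phi> y \<longleftrightarrow> x = y" for x y
      using inj_eq[OF inj_on_inverseI[of UNIV ?\<Psi> ?\<Phi>, OF \<Psi>\<Phi>]] .
    have "?T \<eta> (\<i> *s z) = \<i> *s ?T \<eta> z \<longleftrightarrow> ?D \<eta> (\<ii> * ?\<Psi> z) = \<ii> * ?D \<eta> (?\<Psi> z)" for z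
      by (simp only: comp_def mc_from_coords_mult_i[OF adm]
          mc_coords_mult_unit[OF adm basis, symmetric] inj)
    moreover have "(\<forall>z. ?D \<eta> (\<ii> * ?\<Psi> z) = \<ii> * ?D \<eta> (?\<Psi> z)) \<longleftrightarrow>
        (\<forall>x. ?D \<eta> (\<ii> * x) = \<ii> * ?D \<eta> x)"
      using surjI[of ?\<Psi> ?\<Phi>, OF \<Psi>\<Phi>] by (metis surjD)
    ultimately have "Vector_Spaces.linear (*s) (*s) (?T \<eta>) \<longleftrightarrow> (\<forall>x. ?D \<eta> (\<ii> * x) = \<ii> * ?D \<eta> x)"
      unfolding complex_linear_iff[OF has_derivative_linear[OF dG]] by simp
    then show ?thesis
      unfolding within using dG has_derivative_unique[OF dG] by blast
  qed
  then show ?thesis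
    unfolding holomorphic_in_coords_def holomorphic_map_on_def inv_mc_coords[OF adm basis] by simp
qed

theorem theorem4p5:
  fixes \<sigma> :: "'n::finite multicomplex \<Rightarrow> 'n multicomplex"
    and \<ii> :: "'n multicomplex"
    and U :: "'n multicomplex set"
    and F :: "'n multicomplex \<Rightarrow> 'n multicomplex"
  assumes "e_admissible \<sigma> \<ii>" and "open U" and "C1_on U F"
  shows "(cauchy_riemann \<sigma> \<ii> U F \<longleftrightarrow>
      (\<forall>\<eta>\<in>U. frechet_derivative F (at \<eta>) \<circ> (*) \<ii> = (*) \<ii> \<circ> frechet_derivative F (at \<eta>))) \<and>
    (cauchy_riemann \<sigma> \<ii> U F \<longleftrightarrow>
      (\<exists>\<beta>. real_basis_of \<beta> (fixed_space \<sigma>) \<and> holomorphic_in_coords \<ii> \<beta> U F)) \<and>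
    (cauchy_riemann \<sigma> \<ii> U F \<longleftrightarrow>
      (\<forall>\<beta>. real_basis_of \<beta> (fixed_space \<sigma>) \<longrightarrow> holomorphic_in_coords \<ii> \<beta> U F)) \<and>
    (\<forall>\<tau>. e_admissible \<tau> \<ii> \<longrightarrow>
      {G. C1_on U G \<and> cauchy_riemann \<sigma> \<ii> U G} = {G. C1_on U G \<and> cauchy_riemann \<tau> \<ii> U G})"
proof -
  note CR = cauchy_riemann_iff_commutes
  have hol: "holomorphic_in_coords \<ii> \<beta> U F \<longleftrightarrow> cauchy_riemann \<sigma> \<ii> U F"
    if "real_basis_of \<beta> (fixed_space \<sigma>)" for \<beta>
    using holomorphic_in_coords_iff_commutes[OF assms(1) that assms(2,3)] CR[OF assms(1,3)]
    by (rule trans_sym)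
  obtain \<beta> :: "'n half_index \<Rightarrow> 'n multicomplex" where \<beta>: "real_basis_of \<beta> (fixed_space \<sigma>)"
    by (rule fixed_space_basis_exists[OF assms(1)])
  have "cauchy_riemann \<sigma> \<ii> U F \<longleftrightarrow>
      (\<forall>\<eta>\<in>U. frechet_derivative F (at \<eta>) \<circ> (*) \<ii> = (*) \<ii> \<circ> frechet_derivative F (at \<eta>))"
    unfolding CR[OF assms(1,3)] by (simp add: fun_eq_iff)
  moreover have "cauchy_riemann \<sigma> \<ii> U G \<longleftrightarrow> cauchy_riemann \<tau> \<ii> U G"
    if "e_admissible \<tau> \<ii>" "C1_on U G" for \<tau> G
    unfolding CR[OF assms(1) that(2)] CR[OF that] ..
  ultimately show ?thesis using hol \<beta> by blast
qed

end
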